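(* Let $p\in\mathbb{C}$ with $\Re(p)>0$, $\nu\ge0$ real, $b_1,b_2,b_3\in\mathbb{C}$, $c_1\in\mathbb{C}\setminus\{0,-1,-2,\dots\}$, and $x,y\in\mathbb{C}$ with $|x|<1$, $|y|<1$. Then for every positive integer $n$, $$F_{1,p,\nu}(b_1,b_2+n,b_3;c_1;x,y)=F_{1,p,\nu}(b_1,b_2,b_3;c_1;x,y)+\frac{b_1x}{c_1}\sum_{\ell=1}^nF_{1,p,\nu}(b_1+1,b_2+\ell,b_3;c_1+1;x,y)$$ and $$F_{1,p,\nu}(b_1,b_2,b_3+n;c_1;x,y)=F_{1,p,\nu}(b_1,b_2,b_3;c_1;x,y)+\frac{b_1y}{c_1}\sum_{\ell=1}^nF_{1,p,\nu}(b_1+1,b_2,b_3+\ell;c_1+1;x,y).$$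
   Context: $K_\alpha$ is the modified Bessel function of the second kind of order $\alpha$; powers and square roots take principal values. $(\lambda)_n$ is the Pochhammer symbol $\lambda(\lambda+1)\cdots(\lambda+n-1)$, $(\lambda)_0=1$, and $B(\alpha,\beta)=\Gamma(\alpha)\Gamma(\beta)/\Gamma(\alpha+\beta)$. For $\Re(p)>0$, $\nu\ge0$, $$B_{p,\nu}(u,v)=\sqrt{\frac{2p}{\pi}}\int_0^1 t^{u-\frac32}(1-t)^{v-\frac32}K_{\nu+\frac12}\!\left(\frac{p}{t(1-t)}\right)dt .$$ The extended Appell function is defined for $|x|<1$, $|y|<1$, $b_1,b_2,b_3\in\mathbb{C}$, $c_1\in\mathbb{C}\setminus\{0,-1,-2,\dots\}$ by $$F_{1,p,\nu}(b_1,b_2,b_3;c_1;x,y)=\sum_{m,n=0}^\infty\frac{(b_2)_m(b_3)_n\,B_{p,\nu}(b_1+m+n,c_1-b_1)}{B(b_1,c_1-b_1)}\frac{x^m}{m!}\frac{y^n}{n!},$$ where $1/B(b_1,c_1-b_1)$ is read as $\Gamma(c_1)/(\Gamma(b_1)\Gamma(c_1-b_1))$, with $1/\Gamma$ the entire reciprocal Gamma function. *)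

theory Defs
  imports "HOL-Analysis.Analysis"
begin

(* Modified Bessel function of the first kind, principal branch; meant for z different from 0
   (0 powr a = 0 in Isabelle, also for a = 0). The reciprocal Gamma function is entire, so
   negative integer orders are covered. *)
definition Bessel_I :: "complex \<Rightarrow> complex \<Rightarrow> complex" where
  "Bessel_I a z =
     (z / 2) powr a * (\<Sum>k. rGamma (a + of_nat k + 1) * (z / 2) ^ (2 * k) / fact k)"

(* Modified Bessel function of the second kind (Macdonald function), principal branch;
   at integer orders it is the limit of the values at neighbouring orders. *)
definition Bessel_K :: "complex \<Rightarrow> complex \<Rightarrow> complex" where
  "Bessel_K a z =
     (let K = (\<lambda>b. of_real (pi / 2) * (Bessel_I (- b) z - Bessel_I b z) / sin (b * of_real pi))
      in if a \<in> \<int> then Lim (at a) K else K a)"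

(* The integral converges absolutely for Re p > 0, for all complex u and v, because of the
   exponential decay of Bessel_K at both end points. *)
definition ext_Beta :: "complex \<Rightarrow> real \<Rightarrow> complex \<Rightarrow> complex \<Rightarrow> complex" where
  "ext_Beta p \<nu> u v =
     csqrt (2 * p / of_real pi) *
     (LINT t:{0<..<1}|lborel.
        of_real t powr (u - 3 / 2) * of_real (1 - t) powr (v - 3 / 2) *
        Bessel_K (of_real (\<nu> + 1 / 2)) (p / of_real (t * (1 - t))))"

(* The factor with Gamma and rGamma is 1 / B(b1, c1 - b1) with the reciprocal Gamma function
   in place of 1 / Gamma, so that it vanishes when b1 or c1 - b1 is a pole of Gamma.
   The double series converges absolutely for norm x < 1 and norm y < 1. *)
definition ext_Appell_F1 ::
  "complex \<Rightarrow> real \<Rightarrow> complex \<Rightarrow> complex \<Rightarrow> complex \<Rightarrow> complex \<Rightarrow> complex \<Rightarrow> complex \<Rightarrow> complex"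
where
  "ext_Appell_F1 p \<nu> b1 b2 b3 c1 x y =
     (\<Sum>\<^sub>\<infinity>(m, n)\<in>UNIV.
        pochhammer b2 m * pochhammer b3 n *
        (ext_Beta p \<nu> (b1 + of_nat m + of_nat n) (c1 - b1) *
         (Gamma c1 * rGamma b1 * rGamma (c1 - b1))) *
        (x ^ m / fact m) * (y ^ n / fact n))"

end

theory Submission
  imports Defs
begin

text \<open>
  Everything reduces to the contiguous relation for \<open>b\<^sub>2 + 1\<close>, which is compared coefficientwise:
  \<open>(b + 1)\<^sub>m - (b)\<^sub>m = m (b + 1)\<^sub>m\<^sub>-\<^sub>1\<close>, and the extended Beta factor only depends on \<open>b\<^sub>1 + m + n\<close>
  and \<open>c\<^sub>1 - b\<^sub>1\<close>. The rearrangement needs absolute convergence of the double series, for which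
  boundedness of \<open>k \<mapsto> B\<^sub>p\<^sub>,\<^sub>\<nu>(u + k, v)\<close> suffices. That needs no information about the Bessel
  function: multiplying the integrand by \<open>t \<in> (0, 1)\<close> decreases its absolute value, and wherever
  the integrand is not integrable the Lebesgue integral is \<open>0\<close> by convention.
\<close>

lemma bounded_ext_Beta_shift:
  "\<exists>C. \<forall>k. norm (ext_Beta p \<nu> (u + of_nat k) v) \<le> C"
proof -
  define f :: "nat \<Rightarrow> real \<Rightarrow> complex" where
    "f = (\<lambda>k t. of_real t powr (u + of_nat k - 3 / 2) * of_real (1 - t) powr (v - 3 / 2) *
            Bessel_K (of_real (\<nu> + 1 / 2)) (p / of_real (t * (1 - t))))"
  define g where "g = (\<lambda>k t. indicat_real {0<..<1} t *\<^sub>R f k t)"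
  have beta: "ext_Beta p \<nu> (u + of_nat k) v = csqrt (2 * p / of_real pi) * (LINT t|lborel. g k t)" for k
    unfolding ext_Beta_def set_lebesgue_integral_def g_def f_def ..
  have g_add: "g (k + j) t = of_real t ^ j * g k t" for k j t
  proof (cases "t \<in> {0<..<1}")
    case True
    have "u + of_nat (k + j) - 3 / 2 = (u + of_nat k - 3 / 2) + of_nat j"
      by simp
    then have "(of_real t :: complex) powr (u + of_nat (k + j) - 3 / 2) =
          of_real t powr (u + of_nat k - 3 / 2) * of_real t ^ j"
      using True by (simp only: powr_add) (simp add: powr_nat)
    then show ?thesis
      using True by (simp add: g_def f_def)
  qed (simp add: g_def)
  have norm_g: "norm (g (k + j) t) \<le> norm (g k t)" for k j t
  proof (cases "t \<in> {0<..<1}")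
    case True
    then have "\<bar>t\<bar> ^ j \<le> 1"
      by (intro power_le_one) auto
    then show ?thesis
      by (simp add: g_add norm_mult norm_power mult_left_le_one_le)
  qed (simp add: g_def)
  have bound: "\<exists>C. \<forall>k. norm (LINT t|lborel. g k t) \<le> C"
  proof (cases "\<exists>k. integrable lborel (g k)")
    case False
    then show ?thesis
      by (intro exI[of _ 0]) (auto simp: not_integrable_integral_eq)
  next
    case True
    then obtain k where k: "integrable lborel (g k)" ..
    \<comment> \<open>Integrability at one shift \<open>k\<close> passes to every later shift, since
      \<open>g (k + j)\<close> is \<open>g k\<close> times the continuous factor
      \<open>t ^ j\<close>, of modulus at most 1 on the support.\<close>
    have int: "integrable lborel (g (k + j))" for j
    proof (rule Bochner_Integration.integrable_bound [OF k])
      show "g (k + j) \<in> borel_measurable lborel"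
        using borel_measurable_integrable [OF k] unfolding g_add [abs_def] by measurable
    qed (simp add: norm_g)
    have tail: "norm (LINT t|lborel. g (k + j) t) \<le> (LINT t|lborel. norm (g k t))" for j
      using integral_norm_bound [of lborel "g (k + j)"]
        integral_mono [OF integrable_norm [OF int [of j]] integrable_norm [OF k] norm_g]
      by (rule order_trans)
    \<comment> \<open>The first summand bounds all shifts from \<open>k\<close> on. The second
      covers the finitely many earlier ones, whether or not they are integrable.\<close>
    define C where
      "C = (LINT t|lborel. norm (g k t)) + (\<Sum>i<k. norm (LINT t|lborel. g i t))"
    have "norm (LINT t|lborel. g i t) \<le> C" for i
    proof (cases "i < k")
      case True
      then have "norm (LINT t|lborel. g i t) \<le> (\<Sum>i<k. norm (LINT t|lborel. g i t))"
        by (intro member_le_sum) auto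
      then show ?thesis
        unfolding C_def by (simp add: add_increasing)
    next
      case False
      moreover have "0 \<le> (\<Sum>i<k. norm (LINT t|lborel. g i t))"
        by (simp add: sum_nonneg)
      ultimately show ?thesis
        using tail [of "i - k"] unfolding C_def by simp
    qed
    then show ?thesis by blast
  qed
  then obtain C where "\<And>k. norm (LINT t|lborel. g k t) \<le> C" by blast
  then have "norm (ext_Beta p \<nu> (u + of_nat k) v) \<le> norm (csqrt (2 * p / of_real pi)) * C" for k
    unfolding beta norm_mult by (intro mult_left_mono) auto
  then show ?thesis by blast
qed

text \<open>Up to the sign \<open>(-1) ^ m\<close> the coefficients are those of the binomial series
  with exponent \<open>- b\<close>, whose radius of convergence is at least 1.\<close>

lemma summable_norm_pochhammer:
  fixes b x :: complex
  assumes "norm x < 1"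
  shows "summable (\<lambda>m. norm (pochhammer b m * (x ^ m / fact m)))"
proof -
  have "ereal (norm x) < conv_radius (\<lambda>m. (- b) gchoose m)"
    using assms by (simp add: conv_radius_gchoose)
  then have "summable (\<lambda>m. norm (((- b) gchoose m) * x ^ m))"
    by (rule abs_summable_in_conv_radius)
  then show ?thesis
    by (simp add: gbinomial_pochhammer norm_mult norm_divide norm_power mult_ac)
qed

definition appell_term ::
  "complex \<Rightarrow> real \<Rightarrow> complex \<Rightarrow> complex \<Rightarrow> complex \<Rightarrow> complex \<Rightarrow> complex \<Rightarrow> complex \<Rightarrow> nat \<times> nat \<Rightarrow> complex"
where
  "appell_term p \<nu> b1 b2 b3 c1 x y =
     (\<lambda>(m, n).
        pochhammer b2 m * pochhammer b3 n *
        (ext_Beta p \<nu> (b1 + of_nat m + of_nat n) (c1 - b1) *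
         (Gamma c1 * rGamma b1 * rGamma (c1 - b1))) *
        (x ^ m / fact m) * (y ^ n / fact n))"

lemma ext_Appell_F1_eq: "ext_Appell_F1 p \<nu> b1 b2 b3 c1 x y = infsum (appell_term p \<nu> b1 b2 b3 c1 x y) UNIV"
  unfolding ext_Appell_F1_def appell_term_def ..

text \<open>The Beta factor depends on the indices only through \<open>m + n\<close> and is bounded,
  so a constant times the product of two absolutely convergent single series dominates the double
  series.\<close>

lemma appell_term_summable:
  assumes "norm x < 1" "norm y < 1"
  shows "appell_term p \<nu> b1 b2 b3 c1 x y summable_on UNIV"
proof -
  define D where "D = Gamma c1 * rGamma b1 * rGamma (c1 - b1)"
  define a where "a = (\<lambda>m. norm (pochhammer b2 m * (x ^ m / fact m)))"
  define b where "b = (\<lambda>n. norm (pochhammer b3 n * (y ^ n / fact n)))"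
  obtain C where C: "\<And>k. norm (ext_Beta p \<nu> (b1 + of_nat k) (c1 - b1)) \<le> C"
    using bounded_ext_Beta_shift by blast
  have "a summable_on UNIV" "b summable_on UNIV"
    using assms unfolding a_def b_def
    by (intro norm_summable_imp_summable_on, simp only: real_norm_def abs_norm_cancel summable_norm_pochhammer)+
  then have "(\<lambda>(m, n). a m * b n) summable_on UNIV \<times> UNIV"
    by (intro summable_on_SigmaI [where g = "\<lambda>m. a m * infsum b UNIV"])
       (auto intro!: has_sum_cmult_right summable_on_cmult_left simp: a_def b_def)
  then have "(\<lambda>mn. (C * norm D) * (case mn of (m, n) \<Rightarrow> a m * b n)) summable_on UNIV"
    by (intro summable_on_cmult_right) simp
  moreover have "norm (appell_term p \<nu> b1 b2 b3 c1 x y mn) \<le> (C * norm D) * (case mn of (m, n) \<Rightarrow> a m * b n)"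
    for mn
  proof (cases mn)
    case (Pair m n)
    have "norm (appell_term p \<nu> b1 b2 b3 c1 x y mn) =
          (norm (ext_Beta p \<nu> (b1 + of_nat (m + n)) (c1 - b1)) * norm D) * (a m * b n)"
      by (simp add: Pair appell_term_def a_def b_def D_def norm_mult norm_divide add_ac mult_ac)
    also have "\<dots> \<le> (C * norm D) * (a m * b n)"
      by (intro mult_right_mono C) (auto simp: a_def b_def)
    finally show ?thesis by (simp add: Pair)
  qed
  ultimately have "(\<lambda>mn. norm (appell_term p \<nu> b1 b2 b3 c1 x y mn)) summable_on UNIV"
    by (rule summable_on_comparison_test) auto
  then show ?thesis
    by (rule abs_summable_summable)
qed

text \<open>Both symbols of order \<open>Suc m\<close> contain \<open>pochhammer (b + 1) m\<close>,
  with cofactors \<open>b + 1 + m\<close> and \<open>b\<close>; these differ by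
  \<open>m + 1\<close>.\<close>

lemma pochhammer_plus1_Suc:
  fixes b :: "'a :: comm_ring_1"
  shows "pochhammer (b + 1) (Suc m) = pochhammer b (Suc m) + of_nat (Suc m) * pochhammer (b + 1) m"
  unfolding pochhammer_Suc [of "b + 1"] pochhammer_rec [of b] by (simp add: algebra_simps)

lemma appell_term_plus1_0:
  "appell_term p \<nu> b1 (b2 + 1) b3 c1 x y (0, n) = appell_term p \<nu> b1 b2 b3 c1 x y (0, n)"
  by (simp add: appell_term_def)

text \<open>The new factor \<open>m + 1\<close> cancels against the factorial and frees one
  \<open>x\<close>. Raising both \<open>b1\<close> and \<open>c1\<close> by one absorbs the index
  shift in the Beta factor and leaves \<open>c1 - b1\<close> fixed; \<open>b1 / c1\<close> comes
  from the normalisation.\<close>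

lemma appell_term_plus1_Suc:
  assumes "c1 \<notin> \<int>\<^sub>\<le>\<^sub>0"
  shows "appell_term p \<nu> b1 (b2 + 1) b3 c1 x y (Suc m, n) =
         appell_term p \<nu> b1 b2 b3 c1 x y (Suc m, n) +
         b1 * x / c1 * appell_term p \<nu> (b1 + 1) (b2 + 1) b3 (c1 + 1) x y (m, n)"
proof -
  have "c1 \<noteq> 0" using assms by auto
  \<comment> \<open>The recurrence for \<open>rGamma\<close> holds for every \<open>b1\<close>, so
    the poles of \<open>Gamma\<close> need no separate case.\<close>
  then have Gamma: "Gamma c1 * rGamma b1 = b1 / c1 * (Gamma (c1 + 1) * rGamma (b1 + 1))"
    using Gamma_plus1 [OF assms] rGamma_plus1 [of b1, symmetric] by (simp add: field_simps)
  have fact: "of_nat (Suc m) * (x ^ Suc m / fact (Suc m)) = x * (x ^ m / fact m)"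
    by (simp add: field_simps del: of_nat_Suc)
  define E where "E = ext_Beta p \<nu> (b1 + 1 + of_nat m + of_nat n) (c1 - b1)"
  have E: "E = ext_Beta p \<nu> (b1 + of_nat (Suc m) + of_nat n) (c1 - b1)"
    by (simp add: E_def add_ac)
  \<comment> \<open>\<open>R\<close> collects the factors common to all three terms.\<close>
  define R where "R = pochhammer b3 n * E * rGamma (c1 - b1) * (y ^ n / fact n)"
  have "appell_term p \<nu> b1 (b2 + 1) b3 c1 x y (Suc m, n) =
        appell_term p \<nu> b1 b2 b3 c1 x y (Suc m, n) +
        (Gamma c1 * rGamma b1) * (of_nat (Suc m) * (x ^ Suc m / fact (Suc m))) * (pochhammer (b2 + 1) m * R)"
    unfolding appell_term_def R_def E pochhammer_plus1_Suc prod.case by algebra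
  also have "\<dots> = appell_term p \<nu> b1 b2 b3 c1 x y (Suc m, n) +
        b1 * x / c1 * appell_term p \<nu> (b1 + 1) (b2 + 1) b3 (c1 + 1) x y (m, n)"
    unfolding Gamma fact by (simp add: appell_term_def R_def E_def mult_ac)
  finally show ?thesis .
qed

text \<open>In the difference of the two series the row \<open>m = 0\<close> cancels; the rows
  \<open>Suc m\<close>, reindexed by \<open>m\<close>, form the third series.\<close>

lemma ext_Appell_F1_contiguous:
  assumes "c1 \<notin> \<int>\<^sub>\<le>\<^sub>0" "norm x < 1" "norm y < 1"
  shows "ext_Appell_F1 p \<nu> b1 (b2 + 1) b3 c1 x y =
         ext_Appell_F1 p \<nu> b1 b2 b3 c1 x y +
         b1 * x / c1 * ext_Appell_F1 p \<nu> (b1 + 1) (b2 + 1) b3 (c1 + 1) x y"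
proof -
  let ?S = "appell_term p \<nu> b1 (b2 + 1) b3 c1 x y"
  let ?T = "appell_term p \<nu> b1 b2 b3 c1 x y"
  let ?U = "appell_term p \<nu> (b1 + 1) (b2 + 1) b3 (c1 + 1) x y"
  let ?h = "map_prod Suc (\<lambda>n. n :: nat)"
  note summable = appell_term_summable [OF assms(2,3)]
  have "((\<lambda>mn. ?S mn - ?T mn) has_sum (infsum ?S UNIV - infsum ?T UNIV)) UNIV"
    unfolding diff_conv_add_uminus
    by (intro has_sum_add has_sum_uminusI has_sum_infsum summable)
  then have "infsum ?S UNIV - infsum ?T UNIV = infsum (\<lambda>mn. ?S mn - ?T mn) UNIV"
    by (rule infsumI [symmetric])
  also have "\<dots> = infsum (\<lambda>mn. ?S mn - ?T mn) (range ?h)"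
  proof (rule infsum_cong_neutral)
    fix mn :: "nat \<times> nat"
    assume "mn \<in> UNIV - range ?h"
    then obtain n where "mn = (0, n)"
      by (cases mn; cases "fst mn") (auto simp: image_iff)
    then show "?S mn - ?T mn = 0"
      by (simp add: appell_term_plus1_0)
  qed auto
  also have "\<dots> = infsum ((\<lambda>mn. ?S mn - ?T mn) \<circ> ?h) UNIV"
    by (rule infsum_reindex) (auto simp: inj_on_def)
  also have "(\<lambda>mn. ?S mn - ?T mn) \<circ> ?h = (\<lambda>mn. b1 * x / c1 * ?U mn)"
    by (auto simp: fun_eq_iff appell_term_plus1_Suc [OF assms(1)])
  also have "infsum \<dots> UNIV = b1 * x / c1 * infsum ?U UNIV"
    by (rule infsum_cmult_right) (rule summable)
  finally show ?thesis
    by (simp add: ext_Appell_F1_eq algebra_simps)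
qed

text \<open>The Beta factor is symmetric in the two indices, so exchanging them transfers identities
  from \<open>b2\<close>, \<open>x\<close> to \<open>b3\<close>, \<open>y\<close>.\<close>

lemma ext_Appell_F1_swap: "ext_Appell_F1 p \<nu> b1 b2 b3 c1 x y = ext_Appell_F1 p \<nu> b1 b3 b2 c1 y x"
proof -
  have "infsum (appell_term p \<nu> b1 b2 b3 c1 x y) (range prod.swap) =
        infsum (appell_term p \<nu> b1 b2 b3 c1 x y \<circ> prod.swap) UNIV"
    by (rule infsum_reindex) simp
  also have "appell_term p \<nu> b1 b2 b3 c1 x y \<circ> prod.swap = appell_term p \<nu> b1 b3 b2 c1 y x"
    by (auto simp: fun_eq_iff appell_term_def add_ac mult_ac)
  finally show ?thesis
    by (simp add: ext_Appell_F1_eq)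
qed

text \<open>Iterating the contiguous relation: passing from \<open>n\<close> to \<open>n + 1\<close>
  adds the summand \<open>l = n + 1\<close>.\<close>

lemma ext_Appell_F1_plus_nat:
  assumes "c1 \<notin> \<int>\<^sub>\<le>\<^sub>0" "norm x < 1" "norm y < 1"
  shows "ext_Appell_F1 p \<nu> b1 (b2 + of_nat n) b3 c1 x y =
         ext_Appell_F1 p \<nu> b1 b2 b3 c1 x y +
         b1 * x / c1 * (\<Sum>l = 1..n. ext_Appell_F1 p \<nu> (b1 + 1) (b2 + of_nat l) b3 (c1 + 1) x y)"
proof (induction n)
  case (Suc n)
  have "b2 + of_nat (Suc n) = b2 + of_nat n + 1" by simp
  then show ?case
    using Suc.IH ext_Appell_F1_contiguous [OF assms, of p \<nu> b1 "b2 + of_nat n" b3]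
    by (simp only: sum.cl_ivl_Suc) (simp add: algebra_simps)
qed simp

theorem theorem6:
  fixes p b1 b2 b3 c1 x y :: complex and \<nu> :: real and n :: nat
  assumes "Re p > 0" and "\<nu> \<ge> 0"
    and "c1 \<notin> \<int>\<^sub>\<le>\<^sub>0"
    and "norm x < 1" and "norm y < 1"
    and "n \<ge> 1"
  shows "ext_Appell_F1 p \<nu> b1 (b2 + of_nat n) b3 c1 x y =
           ext_Appell_F1 p \<nu> b1 b2 b3 c1 x y +
           b1 * x / c1 * (\<Sum>l = 1..n. ext_Appell_F1 p \<nu> (b1 + 1) (b2 + of_nat l) b3 (c1 + 1) x y)
       \<and> ext_Appell_F1 p \<nu> b1 b2 (b3 + of_nat n) c1 x y =
           ext_Appell_F1 p \<nu> b1 b2 b3 c1 x y +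
           b1 * y / c1 * (\<Sum>l = 1..n. ext_Appell_F1 p \<nu> (b1 + 1) b2 (b3 + of_nat l) (c1 + 1) x y)"
  using ext_Appell_F1_plus_nat [OF assms(3,4,5), of p \<nu> b1 b2 n b3]
    ext_Appell_F1_plus_nat [OF assms(3,5,4), of p \<nu> b1 b3 n b2]
  \<comment> \<open>Fixing \<open>b2\<close>, \<open>y\<close>, \<open>x\<close> in the pattern
    rewrites only the swapped instance and keeps the symmetric rule from looping.\<close>
  unfolding ext_Appell_F1_swap [of p \<nu> _ _ b2 _ y x] by (rule conjI)

end
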